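(* $$\sum_{r=1}^\infty \frac{H_{r,2}^2}{(r+1)^2}=\frac{59}{22680}\pi^6-\zeta(3)^2 .$$
   Context: For a positive integer $N$, $H_{N,m}=\sum_{r=1}^N \frac{1}{r^m}$ is the generalized harmonic number of order $m$; $H_{r,2}^2$ denotes $(H_{r,2})^2$. $\zeta(m)=\sum_{r=1}^\infty r^{-m}$ is the Riemann zeta function. *)

theory Defs
  imports Complex_Main
begin

definition gen_harm :: "nat \<Rightarrow> nat \<Rightarrow> real" where
  "gen_harm N m = (\<Sum>r=1..N. 1 / real r ^ m)"

text \<open>The zeta function at integers \<open>m \<ge> 2\<close>. The series runs over all positive integers, and
  \<open>suminf\<close> starts at 0, hence the index shift. For \<open>m \<le> 1\<close> the series diverges and
  the value carries no meaning.\<close>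
definition zeta_nat :: "nat \<Rightarrow> real" where
  "zeta_nat m = (\<Sum>r. 1 / real (Suc r) ^ m)"

end

theory Submission
  imports Defs "HOL-Analysis.Analysis"
begin

text \<open>Write \<open>\<zeta>(i,j)\<close> for the sum of \<open>1 / (m ^ i * k ^ j)\<close> over \<open>m > k \<ge> 1\<close>, and \<open>H\<^sub>n\<close> for the
  harmonic number of order 2. Summing
  \<open>H\<^sub>n\<^sub>+\<^sub>1 ^ 3 - H\<^sub>n ^ 3 = 3 * H\<^sub>n\<^sup>2 / (n+1)\<^sup>2 + 3 * H\<^sub>n / (n+1) ^ 4 + 1 / (n+1) ^ 6\<close> expresses the
  series as \<open>(\<zeta>(2) ^ 3 - \<zeta>(6)) / 3 - \<zeta>(4,2)\<close>. Splitting the lattice sum for \<open>\<zeta>(p) * \<zeta>(q)\<close>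
  along the diagonal (stuffle), expanding \<open>1 / (a ^ p * b ^ q)\<close> into partial fractions in
  \<open>a + b\<close> (shuffle), and Euler's sum formula
  \<open>\<zeta>(2,w-2) + \<dots> + \<zeta>(w-1,1) = \<zeta>(w)\<close> give linear relations in weights 4 and 6 from which
  \<open>\<zeta>(4,2) = \<zeta>(3)\<^sup>2 - 4/3 * \<zeta>(6)\<close>, \<open>\<zeta>(2)\<^sup>2 = 5/2 * \<zeta>(4)\<close> and \<open>\<zeta>(2) * \<zeta>(4) = 7/4 * \<zeta>(6)\<close>
  follow. The only transcendental input is \<open>\<zeta>(2) = pi\<^sup>2 / 6\<close>.\<close>

section \<open>Zeta and double zeta values as unordered sums\<close>

text \<open>An unordered sum, so that the index set may be split and reindexed freely.
  \<open>infsum\<close> defaults to 0 without summability; for \<open>i\<close> at least 2,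
  \<open>j\<close> at least 1 and weight \<open>i + j\<close> at least 4, summability is established
  below.\<close>

definition double_zeta :: "nat \<Rightarrow> nat \<Rightarrow> real" where
  "double_zeta i j = (\<Sum>\<^sub>\<infinity>(m, k)\<in>(SIGMA m:{1..}. {1..<m}). 1 / (real m ^ i * real k ^ j))"

lemma has_sum_atLeast_1_imp_sums:
  fixes f :: "nat \<Rightarrow> 'a :: {comm_monoid_add, topological_space}"
  assumes "(f has_sum s) {1..}"
  shows "(\<lambda>n. f (Suc n)) sums s"
proof (rule has_sum_imp_sums)
  show "((\<lambda>n. f (Suc n)) has_sum s) UNIV"
    using assms
    by (subst has_sum_reindex_bij_witness[where i = "\<lambda>n. n - 1" and j = Suc and T = "{1..}" and h = f]) auto
qed

lemma sums_imp_has_sum_atLeast_1: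
  fixes f :: "nat \<Rightarrow> real"
  assumes "(\<lambda>n. f (Suc n)) sums s" "\<And>n. n \<ge> 1 \<Longrightarrow> f n \<ge> 0"
  shows "(f has_sum s) {1..}"
proof -
  have "((\<lambda>n. f (Suc n)) has_sum s) UNIV"
    by (rule sums_nonneg_imp_has_sum) (use assms in auto)
  thus ?thesis
    by (subst has_sum_reindex_bij_witness[where j = "\<lambda>n. n - 1" and i = Suc and T = UNIV and h = "\<lambda>n. f (Suc n)"]) auto
qed

lemma zeta_nat_has_sum:
  assumes "p \<ge> 2"
  shows "((\<lambda>n. 1 / real n ^ p) has_sum zeta_nat p) {1..}"
proof (rule sums_imp_has_sum_atLeast_1)
  have "summable (\<lambda>n. 1 / real (Suc n) ^ p)"
    using inverse_power_summable[OF assms, where ?'a = real]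
    by (subst summable_Suc_iff) (simp add: field_simps)
  thus "(\<lambda>n. 1 / real (Suc n) ^ p) sums zeta_nat p"
    unfolding zeta_nat_def by (rule summable_sums)
qed auto

lemma zeta_nat_mult_has_sum:
  assumes "p \<ge> 2" "q \<ge> 2"
  shows "((\<lambda>(a, b). 1 / (real a ^ p * real b ^ q)) has_sum zeta_nat p * zeta_nat q) ({1..} \<times> {1..})"
proof (rule has_sum_SigmaI)
  show "((\<lambda>b. case (a, b) of (a, b) \<Rightarrow> 1 / (real a ^ p * real b ^ q)) has_sum
          1 / real a ^ p * zeta_nat q) {1..}" for a :: nat
    using has_sum_cmult_right[OF zeta_nat_has_sum[OF assms(2)], of "1 / real a ^ p"] by simp
  show g: "((\<lambda>a. 1 / real a ^ p * zeta_nat q) has_sum zeta_nat p * zeta_nat q) {1..}"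
    using has_sum_cmult_left[OF zeta_nat_has_sum[OF assms(1)], of "zeta_nat q"] by simp
  show "(\<lambda>(a, b). 1 / (real a ^ p * real b ^ q)) summable_on {1..} \<times> {1..}"
  proof (rule summable_on_SigmaI)
    show "((\<lambda>b. case (a, b) of (a, b) \<Rightarrow> 1 / (real a ^ p * real b ^ q)) has_sum
          1 / real a ^ p * zeta_nat q) {1..}" for a :: nat
      using has_sum_cmult_right[OF zeta_nat_has_sum[OF assms(2)], of "1 / real a ^ p"] by simp
    show "(\<lambda>a. 1 / real a ^ p * zeta_nat q) summable_on {1..}"
      using g by (rule has_sum_imp_summable)
  qed auto
qed

text \<open>Serves to dominate double zeta terms by those of \<open>zeta_nat 2 * zeta_nat 2\<close>.
  For \<open>j = 1\<close> the missing factor \<open>x\<close> is taken from a third power of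
  \<open>x + y\<close>; the weight condition excludes \<open>i = 2\<close>, \<open>j = 1\<close>,
  where the bound fails for large \<open>x = y\<close>.\<close>

lemma add_power_mult_power_ge:
  fixes x y :: real
  assumes "x \<ge> 1" "y \<ge> 1" "i \<ge> 2" "j \<ge> 1" "i + j \<ge> 4"
  shows "x ^ 2 * y ^ 2 \<le> (x + y) ^ i * x ^ j"
proof (cases "j \<ge> 2")
  case True
  have "y ^ 2 \<le> (x + y) ^ 2" "(x + y) ^ 2 \<le> (x + y) ^ i" "x ^ 2 \<le> x ^ j"
    using assms True by (auto intro: power_mono power_increasing)
  hence "y ^ 2 \<le> (x + y) ^ i" "x ^ 2 \<le> x ^ j" by linarith+
  hence "y ^ 2 * x ^ 2 \<le> (x + y) ^ i * x ^ j"
    using assms by (intro mult_mono) auto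
  thus ?thesis by (simp add: mult.commute)
next
  case False
  with assms have "j = 1" "i \<ge> 3" by auto
  have "x * y ^ 2 \<le> (x + y) * (x + y) ^ 2"
    using assms by (intro mult_mono power_mono) auto
  also have "\<dots> = (x + y) ^ 3" by (simp add: power3_eq_cube power2_eq_square)
  also have "\<dots> \<le> (x + y) ^ i" using assms \<open>i \<ge> 3\<close> by (intro power_increasing) auto
  finally have "x * y ^ 2 * x \<le> (x + y) ^ i * x" using assms by (intro mult_right_mono) auto
  thus ?thesis using \<open>j = 1\<close> by (simp add: power2_eq_square mult_ac)
qed

text \<open>The substitution m = a + b, k = a carries the triangle to the full quadrant, where
  partial fractions in a + b apply.\<close>

lemma double_zeta_has_sum_add:
  assumes "i \<ge> 2" "j \<ge> 1" "i + j \<ge> 4"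
  shows "((\<lambda>(a, b). 1 / ((real a + real b) ^ i * real a ^ j)) has_sum double_zeta i j) ({1..} \<times> {1..})"
proof -
  have "(\<lambda>(a, b). 1 / ((real a + real b) ^ i * real a ^ j)) summable_on {1..} \<times> {1..}"
  proof (rule summable_on_comparison_test)
    show "(\<lambda>(a, b). 1 / (real a ^ 2 * real b ^ 2)) summable_on {1..} \<times> {1..}"
      by (rule has_sum_imp_summable[OF zeta_nat_mult_has_sum]) auto
    show "(case x of (a, b) \<Rightarrow> 1 / ((real a + real b) ^ i * real a ^ j)) \<le>
        (case x of (a, b) \<Rightarrow> 1 / (real a ^ 2 * real b ^ 2))" if "x \<in> {1..} \<times> {1..}" for x
      using that assms
      by (auto intro!: divide_left_mono add_power_mult_power_ge mult_pos_pos zero_less_power)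
  qed auto
  hence "((\<lambda>(a, b). 1 / ((real a + real b) ^ i * real a ^ j)) has_sum
      (\<Sum>\<^sub>\<infinity>(a, b)\<in>{1..} \<times> {1..}. 1 / ((real a + real b) ^ i * real a ^ j))) ({1..} \<times> {1..})"
    by (rule has_sum_infsum)
  also have "(\<Sum>\<^sub>\<infinity>(a, b)\<in>{1..} \<times> {1..}. 1 / ((real a + real b) ^ i * real a ^ j)) = double_zeta i j"
    unfolding double_zeta_def
    by (rule infsum_reindex_bij_witness[where i = "\<lambda>(m, k). (k, m - k)" and j = "\<lambda>(a, b). (a + b, a)"]) auto
  finally show ?thesis .
qed

lemma double_zeta_has_sum_add':
  assumes "i \<ge> 2" "j \<ge> 1" "i + j \<ge> 4"
  shows "((\<lambda>(a, b). 1 / ((real a + real b) ^ i * real b ^ j)) has_sum double_zeta i j) ({1..} \<times> {1..})"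
  using double_zeta_has_sum_add[OF assms]
  by (subst has_sum_reindex_bij_witness[where i = prod.swap and j = prod.swap
        and T = "{1..} \<times> {1..}" and h = "\<lambda>(a, b). 1 / ((real a + real b) ^ i * real a ^ j)"])
    (auto simp: add.commute)

lemma double_zeta_has_sum:
  assumes "i \<ge> 2" "j \<ge> 1" "i + j \<ge> 4"
  shows "((\<lambda>(m, k). 1 / (real m ^ i * real k ^ j)) has_sum double_zeta i j) (SIGMA m:{1..}. {1..<m})"
  using double_zeta_has_sum_add[OF assms]
  by (subst has_sum_reindex_bij_witness[where i = "\<lambda>(a, b). (a + b, a)" and j = "\<lambda>(m, k). (k, m - k)"
        and T = "{1..} \<times> {1..}" and h = "\<lambda>(a, b). 1 / ((real a + real b) ^ i * real a ^ j)"]) auto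

text \<open>Summing over k first leaves a harmonic number. The case \<open>j = 1\<close> serves
  Euler's sum formula, the case \<open>j = 2\<close> the final telescoping.\<close>

lemma gen_harm_double_zeta_has_sum:
  assumes "i \<ge> 2" "j \<ge> 1" "i + j \<ge> 4"
  shows "((\<lambda>m. gen_harm (m - 1) j / real m ^ i) has_sum double_zeta i j) {1..}"
proof (rule has_sum_SigmaD[OF double_zeta_has_sum[OF assms]])
  fix m :: nat assume "m \<in> {1..}"
  hence "{1..<m} = {1..m - 1}" by auto
  hence "gen_harm (m - 1) j / real m ^ i = (\<Sum>k\<in>{1..<m}. 1 / (real m ^ i * real k ^ j))"
    by (simp add: gen_harm_def sum_divide_distrib field_simps)
  thus "((\<lambda>k. case (m, k) of (m, k) \<Rightarrow> 1 / (real m ^ i * real k ^ j)) has_sum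
      gen_harm (m - 1) j / real m ^ i) {1..<m}"
    by (auto intro: has_sum_finiteI)
qed

section \<open>Stuffle products\<close>

text \<open>The quadrant is cut into a > b, its mirror image and the diagonal, which contribute the
  three summands in this order.\<close>

lemma zeta_nat_stuffle:
  assumes "p \<ge> 2" "q \<ge> 2"
  shows "zeta_nat p * zeta_nat q = double_zeta p q + double_zeta q p + zeta_nat (p + q)"
proof -
  let ?f = "\<lambda>(a, b). 1 / (real a ^ p * real b ^ q)"
  let ?L = "SIGMA m:{1::nat..}. {1..<m}"
  have 1: "(?f has_sum double_zeta p q) ?L"
    using double_zeta_has_sum[of p q] assms by simp
  have 2: "(?f has_sum double_zeta q p) (prod.swap ` ?L)"
    using double_zeta_has_sum[of q p] assms
    by (subst has_sum_reindex) (auto simp: o_def case_prod_unfold mult.commute)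
  have 3: "(?f has_sum zeta_nat (p + q)) ((\<lambda>n. (n, n)) ` {1..})"
    using zeta_nat_has_sum[of "p + q"] assms
    by (subst has_sum_reindex) (auto simp: o_def inj_on_def power_add)
  have "(?f has_sum (double_zeta p q + double_zeta q p + zeta_nat (p + q)))
      (?L \<union> prod.swap ` ?L \<union> (\<lambda>n. (n, n)) ` {1..})"
    by (intro has_sum_Un_disjoint 1 2 3) auto
  also have "?L \<union> prod.swap ` ?L \<union> (\<lambda>n. (n, n)) ` {1..} = {1..} \<times> {1..}"
    by (auto simp: image_iff)
  finally show ?thesis
    using zeta_nat_mult_has_sum[OF assms] has_sum_unique by blast
qed

section \<open>Shuffle products by partial fractions\<close>

text \<open>With u = 1/x, v = 1/y and w = 1/(x + y) this reads u v = w (u + v), the one relation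
  from which all shuffle expansions below are derived.\<close>

lemma inverse_mult_inverse_add:
  fixes x y :: real
  assumes "x > 0" "y > 0"
  shows "1 / x * (1 / y) = 1 / (x + y) * (1 / x + 1 / y)"
proof -
  have "x + y \<noteq> 0" using assms by linarith
  thus ?thesis using assms by (simp add: divide_simps)
qed

text \<open>Partial fractions of 1/(a^p b^p) are symmetric in a and b, so their terms come in such
  mirrored pairs.\<close>

definition symmetric_term :: "nat \<Rightarrow> nat \<Rightarrow> nat \<times> nat \<Rightarrow> real" where
  "symmetric_term i j =
     (\<lambda>(a, b). 1 / ((real a + real b) ^ i * real a ^ j) + 1 / ((real a + real b) ^ i * real b ^ j))"

lemma symmetric_term_has_sum:
  assumes "i \<ge> 2" "j \<ge> 1" "i + j \<ge> 4"
  shows "(symmetric_term i j has_sum 2 * double_zeta i j) ({1..} \<times> {1..})"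
  using has_sum_add[OF double_zeta_has_sum_add[OF assms] double_zeta_has_sum_add'[OF assms]]
  by (simp add: symmetric_term_def case_prod_unfold)

lemma zeta_nat_2_2_shuffle:
  "zeta_nat 2 * zeta_nat 2 = 2 * double_zeta 2 2 + 4 * double_zeta 3 1"
proof -
  have "((\<lambda>x. symmetric_term 2 2 x + 2 * symmetric_term 3 1 x) has_sum (2 * double_zeta 2 2 + 2 * (2 * double_zeta 3 1))) ({1..} \<times> {1..})"
    by (intro has_sum_add has_sum_cmult_right symmetric_term_has_sum) auto
  also have "?this \<longleftrightarrow> ((\<lambda>(a, b). 1 / (real a ^ 2 * real b ^ 2)) has_sum
      (2 * double_zeta 2 2 + 2 * (2 * double_zeta 3 1))) ({1..} \<times> {1..})"
  proof (rule has_sum_cong)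
    \<comment> \<open>The left side is w^2 (u + v)^2, and its cross term 2 w^2 u v becomes 2 w^3 (u
      + v).\<close>
    have *: "u ^ 2 * v ^ 2 = (w ^ 2 * u ^ 2 + w ^ 2 * v ^ 2) + 2 * (w ^ 3 * u + w ^ 3 * v)"
      if "u * v = w * (u + v)" for u v w :: real
      using that by algebra
    show "symmetric_term 2 2 x + 2 * symmetric_term 3 1 x = (case x of (a, b) \<Rightarrow> 1 / (real a ^ 2 * real b ^ 2))"
      if "x \<in> {1..} \<times> {1..}" for x
      using that *[OF inverse_mult_inverse_add[of "real (fst x)" "real (snd x)"]]
      by (auto simp: symmetric_term_def power_divide)
  qed
  finally show ?thesis
    using zeta_nat_mult_has_sum[of 2 2] has_sum_unique by fastforce
qed

lemma zeta_nat_3_3_shuffle: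
  "zeta_nat 3 * zeta_nat 3 = 2 * double_zeta 3 3 + 6 * double_zeta 4 2 + 12 * double_zeta 5 1"
proof -
  have "((\<lambda>x. symmetric_term 3 3 x + 3 * symmetric_term 4 2 x + 6 * symmetric_term 5 1 x) has_sum
      (2 * double_zeta 3 3 + 3 * (2 * double_zeta 4 2) + 6 * (2 * double_zeta 5 1))) ({1..} \<times> {1..})"
    by (intro has_sum_add has_sum_cmult_right symmetric_term_has_sum) auto
  also have "?this \<longleftrightarrow> ((\<lambda>(a, b). 1 / (real a ^ 3 * real b ^ 3)) has_sum
      (2 * double_zeta 3 3 + 3 * (2 * double_zeta 4 2) + 6 * (2 * double_zeta 5 1))) ({1..} \<times> {1..})"
  proof (rule has_sum_cong)
    \<comment> \<open>In w^3 (u + v)^3 the mixed part is 3 w^3 u v (u + v) = 3 w^4 (u + v)^2, whose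
      cross term is in turn 6 w^4 u v = 6 w^5 (u + v).\<close>
    have *: "u ^ 3 * v ^ 3 = (w ^ 3 * u ^ 3 + w ^ 3 * v ^ 3) + 3 * (w ^ 4 * u ^ 2 + w ^ 4 * v ^ 2)
        + 6 * (w ^ 5 * u + w ^ 5 * v)"
      if "u * v = w * (u + v)" for u v w :: real
      using that by algebra
    show "symmetric_term 3 3 x + 3 * symmetric_term 4 2 x + 6 * symmetric_term 5 1 x = (case x of (a, b) \<Rightarrow> 1 / (real a ^ 3 * real b ^ 3))"
      if "x \<in> {1..} \<times> {1..}" for x
      using that *[OF inverse_mult_inverse_add[of "real (fst x)" "real (snd x)"]]
      by (auto simp: symmetric_term_def power_divide)
  qed
  finally show ?thesis
    using zeta_nat_mult_has_sum[of 3 3] has_sum_unique by fastforce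
qed

lemma zeta_nat_2_4_shuffle:
  "zeta_nat 2 * zeta_nat 4 =
     double_zeta 2 4 + 2 * double_zeta 3 3 + 4 * double_zeta 4 2 + 8 * double_zeta 5 1"
proof -
  \<comment> \<open>The exponents 2 and 4 differ, so some terms lack a mirror image;
    \<open>E\<close> is the half of \<open>symmetric_term\<close> with powers of b.\<close>
  define E :: "nat \<Rightarrow> nat \<Rightarrow> nat \<times> nat \<Rightarrow> real" where
    "E i j = (\<lambda>(a, b). 1 / ((real a + real b) ^ i * real b ^ j))" for i j
  note E = double_zeta_has_sum_add'[folded E_def]
  have "((\<lambda>x. E 2 4 x + 2 * E 3 3 x + 2 * E 4 2 x + symmetric_term 4 2 x + 4 * symmetric_term 5 1 x) has_sum
      (double_zeta 2 4 + 2 * double_zeta 3 3 + 2 * double_zeta 4 2 + 2 * double_zeta 4 2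
        + 4 * (2 * double_zeta 5 1))) ({1..} \<times> {1..})"
    by (intro has_sum_add has_sum_cmult_right symmetric_term_has_sum E) auto
  also have "?this \<longleftrightarrow> ((\<lambda>(a, b). 1 / (real a ^ 2 * real b ^ 4)) has_sum
      (double_zeta 2 4 + 2 * double_zeta 3 3 + 2 * double_zeta 4 2 + 2 * double_zeta 4 2
        + 4 * (2 * double_zeta 5 1))) ({1..} \<times> {1..})"
  proof (rule has_sum_cong)
    \<comment> \<open>Multiply the expansion of u^2 v^2 by v^2 and keep replacing u v by w (u +
      v).\<close>
    have *: "u ^ 2 * v ^ 4 = w ^ 2 * v ^ 4 + 2 * (w ^ 3 * v ^ 3) + 2 * (w ^ 4 * v ^ 2)
        + (w ^ 4 * u ^ 2 + w ^ 4 * v ^ 2) + 4 * (w ^ 5 * u + w ^ 5 * v)"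
      if "u * v = w * (u + v)" for u v w :: real
      using that by algebra
    show "E 2 4 x + 2 * E 3 3 x + 2 * E 4 2 x + symmetric_term 4 2 x + 4 * symmetric_term 5 1 x =
        (case x of (a, b) \<Rightarrow> 1 / (real a ^ 2 * real b ^ 4))"
      if "x \<in> {1..} \<times> {1..}" for x
      using that *[OF inverse_mult_inverse_add[of "real (fst x)" "real (snd x)"]]
      by (auto simp: symmetric_term_def E_def power_divide)
  qed
  finally show ?thesis
    using zeta_nat_mult_has_sum[of 2 4] has_sum_unique by fastforce
qed

section \<open>Euler's sum formula\<close>

text \<open>Passing from a to a + 1 adds a series that telescopes to 1/(a + 1).\<close>

lemma inverse_diff_shift_sums_gen_harm:
  "(\<lambda>b. 1 / real (Suc b) - 1 / real (a + Suc b)) sums gen_harm a 1"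
proof (induction a)
  case 0
  show ?case by (simp add: gen_harm_def)
next
  case (Suc a)
  have "(\<lambda>b. 1 / real (a + Suc b)) \<longlonglongrightarrow> 0"
    by real_asymp
  from telescope_sums'[OF this]
  have "(\<lambda>b. 1 / real (a + Suc b) - 1 / real (a + Suc (Suc b))) sums (1 / real (Suc a))"
    by simp
  from sums_add[OF Suc this] show ?case
    by (simp add: gen_harm_def)
qed

lemma inverse_mult_add_has_sum_gen_harm:
  assumes "a \<ge> 1"
  shows "((\<lambda>b. 1 / (real b * (real a + real b))) has_sum gen_harm a 1 / real a) {1..}"
proof (rule sums_imp_has_sum_atLeast_1)
  have "1 / (real (Suc b) * (real a + real (Suc b))) = (1 / real (Suc b) - 1 / real (a + Suc b)) / real a" for b
  proof -
    have "real a \<noteq> 0" "real a + real (Suc b) \<noteq> 0" "real (Suc b) \<noteq> 0" using assms by linarith+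
    thus ?thesis unfolding of_nat_add by (simp add: divide_simps del: of_nat_Suc)
  qed
  thus "(\<lambda>b. 1 / (real (Suc b) * (real a + real (Suc b)))) sums (gen_harm a 1 / real a)"
    using sums_divide[OF inverse_diff_shift_sums_gen_harm[of a], of "real a"] by presburger
qed auto

text \<open>A finite geometric progression with ratio x/(x + y); the separate term on the left
  compensates for its truncation.\<close>

lemma geometric_partial_fraction:
  fixes x y :: real
  assumes "x > 0" "y > 0" "w \<ge> 2"
  shows "(\<Sum>i=2..<w. 1 / ((x + y) ^ i * x ^ (w - i))) + 1 / ((x + y) ^ (w - 1) * y)
           = 1 / x ^ (w - 2) * (1 / (y * (x + y)))"
  using \<open>w \<ge> 2\<close>
proof (induction w rule: dec_induct)
  case base
  show ?case by (simp add: mult.commute)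
next
  case (step w)
  have n: "x + y \<noteq> 0" using assms by linarith
  have "(\<Sum>i=2..<Suc w. 1 / ((x + y) ^ i * x ^ (Suc w - i))) =
      (\<Sum>i=2..<w. 1 / ((x + y) ^ i * x ^ (w - i))) / x + 1 / ((x + y) ^ w * x)"
    using step(1) by (simp add: sum_divide_distrib Suc_diff_le mult_ac)
  also have "(\<Sum>i=2..<w. 1 / ((x + y) ^ i * x ^ (w - i))) =
      1 / x ^ (w - 2) * (1 / (y * (x + y))) - 1 / ((x + y) ^ (w - 1) * y)"
    using step.IH by simp
  finally have eq: "(\<Sum>i=2..<Suc w. 1 / ((x + y) ^ i * x ^ (Suc w - i))) =
      (1 / x ^ (w - 2) * (1 / (y * (x + y))) - 1 / ((x + y) ^ (w - 1) * y)) / x + 1 / ((x + y) ^ w * x)" .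
  obtain k where w: "w = Suc (Suc k)" using step(1) by (metis add_2_eq_Suc le_Suc_ex)
  show ?case
    unfolding eq unfolding w using n assms by (simp add: divide_simps) (simp add: algebra_simps)
qed

lemma has_sum_sum:
  fixes f :: "'i \<Rightarrow> 'a \<Rightarrow> 'b :: topological_comm_monoid_add"
  assumes "finite I" "\<And>i. i \<in> I \<Longrightarrow> (f i has_sum s i) A"
  shows "((\<lambda>x. \<Sum>i\<in>I. f i x) has_sum (\<Sum>i\<in>I. s i)) A"
  using assms by (induction I rule: finite_induct) (auto intro: has_sum_add)

text \<open>With \<open>double_zeta (w - 1) 1\<close> added, the summands over the quadrant collapse
  by the geometric sum. Summing over b first then gives
  \<open>gen_harm a 1 / real a ^ (w - 1)\<close>; splitting off the last term of the harmonic number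
  yields \<open>double_zeta (w - 1) 1 + zeta_nat w\<close>, and the added value cancels.\<close>

lemma double_zeta_sum_formula:
  assumes "w \<ge> 4"
  shows "(\<Sum>i=2..<w. double_zeta i (w - i)) = zeta_nat w"
proof -
  have "((\<lambda>x. (\<Sum>i=2..<w. case x of (a, b) \<Rightarrow> 1 / ((real a + real b) ^ i * real a ^ (w - i)))
          + (case x of (a, b) \<Rightarrow> 1 / ((real a + real b) ^ (w - 1) * real b ^ 1))) has_sum
        ((\<Sum>i=2..<w. double_zeta i (w - i)) + double_zeta (w - 1) 1)) ({1..} \<times> {1..})"
    using assms
    by (intro has_sum_add has_sum_sum double_zeta_has_sum_add double_zeta_has_sum_add') auto
  also have "?this \<longleftrightarrow> ((\<lambda>(a, b). 1 / real a ^ (w - 2) * (1 / (real b * (real a + real b)))) has_sum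
        ((\<Sum>i=2..<w. double_zeta i (w - i)) + double_zeta (w - 1) 1)) ({1..} \<times> {1..})"
    using assms geometric_partial_fraction by (intro has_sum_cong) auto
  finally have "((\<lambda>a. 1 / real a ^ (w - 2) * (gen_harm a 1 / real a)) has_sum
      ((\<Sum>i=2..<w. double_zeta i (w - i)) + double_zeta (w - 1) 1)) {1..}"
    by (rule has_sum_SigmaD)
      (unfold prod.case, intro has_sum_cmult_right inverse_mult_add_has_sum_gen_harm, simp)
  also have "?this \<longleftrightarrow> ((\<lambda>a. gen_harm (a - 1) 1 / real a ^ (w - 1) + 1 / real a ^ w) has_sum
      ((\<Sum>i=2..<w. double_zeta i (w - i)) + double_zeta (w - 1) 1)) {1..}"
  proof (rule has_sum_cong)
    fix a :: nat assume "a \<in> {1..}"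
    then obtain n where a: "a = Suc n" by (cases a) auto
    obtain k where w: "w = Suc (Suc k)" using assms by (intro that[of "w - 2"]) simp
    show "1 / real a ^ (w - 2) * (gen_harm a 1 / real a) = gen_harm (a - 1) 1 / real a ^ (w - 1) + 1 / real a ^ w"
    proof -
      have "gen_harm a 1 = gen_harm (a - 1) 1 + 1 / real a"
        by (simp add: a gen_harm_def)
      moreover have "1 / x ^ k * ((h + 1 / x) / x) = h / x ^ Suc k + 1 / x ^ Suc (Suc k)" for x h :: real
        by (simp add: add_divide_distrib distrib_left mult.commute)
      ultimately show ?thesis by (simp add: w)
    qed
  qed
  finally have 1: "((\<lambda>a. gen_harm (a - 1) 1 / real a ^ (w - 1) + 1 / real a ^ w) has_sum
      ((\<Sum>i=2..<w. double_zeta i (w - i)) + double_zeta (w - 1) 1)) {1..}" .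
  have "((\<lambda>a. gen_harm (a - 1) 1 / real a ^ (w - 1) + 1 / real a ^ w) has_sum
      (double_zeta (w - 1) 1 + zeta_nat w)) {1..}"
    using assms by (intro has_sum_add gen_harm_double_zeta_has_sum zeta_nat_has_sum) auto
  from has_sum_unique[OF 1 this] show ?thesis by simp
qed

section \<open>Linear relations in weights 4 and 6\<close>

lemma zeta_nat_2: "zeta_nat 2 = pi ^ 2 / 6"
  using inverse_squares_sums by (simp add: zeta_nat_def sums_iff add.commute)

text \<open>Stuffle against shuffle gives \<open>double_zeta 3 1\<close> as a quarter of
  \<open>zeta_nat 4\<close>; the sum formula leaves three quarters for
  \<open>double_zeta 2 2\<close>.\<close>

lemma zeta_nat_4: "zeta_nat 4 = pi ^ 4 / 90"
proof -
  have "double_zeta 2 2 + double_zeta 3 1 = zeta_nat 4"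
    using double_zeta_sum_formula[of 4] by (simp add: numeral_eq_Suc)
  moreover have "zeta_nat 2 * zeta_nat 2 = 2 * double_zeta 2 2 + zeta_nat 4"
    using zeta_nat_stuffle[of 2 2] by simp
  ultimately have "5 * zeta_nat 4 = 2 * (zeta_nat 2 * zeta_nat 2)"
    using zeta_nat_2_2_shuffle by linarith
  thus ?thesis by (simp add: zeta_nat_2 power_eq_if)
qed

text \<open>Two stuffles, two shuffles and the sum formula are five linear equations. Eliminating
  the four double zeta values and \<open>zeta_nat 3 * zeta_nat 3\<close> gives the first claim;
  keeping the latter as a parameter and solving for \<open>double_zeta 4 2\<close> gives the
  second.\<close>

lemma
  shows zeta_nat_2_4: "4 * (zeta_nat 2 * zeta_nat 4) = 7 * zeta_nat 6"
    and double_zeta_4_2: "double_zeta 4 2 = (zeta_nat 3)\<^sup>2 - 4 / 3 * zeta_nat 6"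
proof -
  have "double_zeta 2 4 + double_zeta 3 3 + double_zeta 4 2 + double_zeta 5 1 = zeta_nat 6"
    using double_zeta_sum_formula[of 6] by (simp add: numeral_eq_Suc)
  moreover have "zeta_nat 2 * zeta_nat 4 = double_zeta 2 4 + double_zeta 4 2 + zeta_nat 6"
    using zeta_nat_stuffle[of 2 4] by simp
  moreover have "zeta_nat 3 * zeta_nat 3 = 2 * double_zeta 3 3 + zeta_nat 6"
    using zeta_nat_stuffle[of 3 3] by simp
  ultimately show "4 * (zeta_nat 2 * zeta_nat 4) = 7 * zeta_nat 6"
    and "double_zeta 4 2 = (zeta_nat 3)\<^sup>2 - 4 / 3 * zeta_nat 6"
    using zeta_nat_2_4_shuffle zeta_nat_3_3_shuffle unfolding power2_eq_square by linarith+
qed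

lemma zeta_nat_6: "zeta_nat 6 = pi ^ 6 / 945"
  using zeta_nat_2_4 by (simp add: zeta_nat_2 zeta_nat_4 power_eq_if)

section \<open>Telescoping the cubes of harmonic numbers\<close>

theorem mainTheorem3:
  "(\<lambda>r. (gen_harm (Suc r) 2)\<^sup>2 / (real (Suc r) + 1)\<^sup>2) sums
     (59 / 22680 * pi ^ 6 - (zeta_nat 3)\<^sup>2)"
proof -
  define h where "h n = gen_harm n 2" for n
  have "(\<lambda>n. \<Sum>r<n. 1 / real (Suc r) ^ 2) \<longlonglongrightarrow> zeta_nat 2"
    using has_sum_atLeast_1_imp_sums[OF zeta_nat_has_sum[of 2]] by (simp add: sums_def)
  moreover have "(\<Sum>r<n. 1 / real (Suc r) ^ 2) = h n" for n
    by (induction n) (simp_all add: h_def gen_harm_def)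
  ultimately have "h \<longlonglongrightarrow> zeta_nat 2" by simp
  hence "(\<lambda>n. h n ^ 3) \<longlonglongrightarrow> zeta_nat 2 ^ 3"
    by (rule tendsto_power)
  from telescope_sums[OF this]
  have "(\<lambda>n. h (Suc n) ^ 3 - h n ^ 3) sums (zeta_nat 2 ^ 3)"
    by (simp add: h_def gen_harm_def)
  moreover have "(\<lambda>n. h n / real (Suc n) ^ 4) sums double_zeta 4 2"
    using has_sum_atLeast_1_imp_sums[OF gen_harm_double_zeta_has_sum[of 4 2]] by (simp add: h_def)
  moreover have "(\<lambda>n. 1 / real (Suc n) ^ 6) sums zeta_nat 6"
    using has_sum_atLeast_1_imp_sums[OF zeta_nat_has_sum[of 6]] by simp
  ultimately have "(\<lambda>n. (h (Suc n) ^ 3 - h n ^ 3 - 3 * (h n / real (Suc n) ^ 4) - 1 / real (Suc n) ^ 6) / 3)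
      sums ((zeta_nat 2 ^ 3 - 3 * double_zeta 4 2 - zeta_nat 6) / 3)"
    by (intro sums_divide sums_diff sums_mult)
  also have "(\<lambda>n. (h (Suc n) ^ 3 - h n ^ 3 - 3 * (h n / real (Suc n) ^ 4) - 1 / real (Suc n) ^ 6) / 3) =
      (\<lambda>n. (h n)\<^sup>2 / (real n + 1)\<^sup>2)"
  proof
    fix n
    have h: "h (Suc n) = h n + (1 / real (Suc n)) ^ 2"
      by (simp add: h_def gen_harm_def power_divide)
    \<comment> \<open>Here \<open>u\<close> stands for 1/(n + 1), so that \<open>h + u ^ 2\<close>
      is the next harmonic number.\<close>
    have "((h + u ^ 2) ^ 3 - h ^ 3 - 3 * (h * u ^ 4) - u ^ 6) / 3 = h ^ 2 * u ^ 2" for h u :: real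
      by algebra
    from this[of "h n" "1 / real (Suc n)"]
    show "(h (Suc n) ^ 3 - h n ^ 3 - 3 * (h n / real (Suc n) ^ 4) - 1 / real (Suc n) ^ 6) / 3
        = (h n)\<^sup>2 / (real n + 1)\<^sup>2"
      unfolding h by (simp add: power_divide add.commute)
  qed
  \<comment> \<open>The part \<open>zeta_nat 2 ^ 3 / 3\<close> is pi^6/648, the multiples 4/3 and
    -1/3 of \<open>zeta_nat 6\<close> add up to pi^6/945, and 1/648 + 1/945 = 59/22680.\<close>
  also have "(zeta_nat 2 ^ 3 - 3 * double_zeta 4 2 - zeta_nat 6) / 3 = 59 / 22680 * pi ^ 6 - (zeta_nat 3)\<^sup>2"
    by (simp add: double_zeta_4_2 zeta_nat_2 zeta_nat_6 power_divide field_simps flip: power_mult)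
  \<comment> \<open>The series obtained starts at n = 0, where \<open>h 0 = 0\<close>; dropping this
    zero term gives the shifted index.\<close>
  finally show ?thesis
    using sums_Suc_iff[of "\<lambda>n. (h n)\<^sup>2 / (real n + 1)\<^sup>2"] by (simp add: h_def gen_harm_def)
qed

end
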